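(* Let $A$ be a left brace and let $X\subseteq A$ be a subset such that the restriction $r=r_A|_{X\times X}$ gives a non-degenerate solution $(X,r)$ to the Yang--Baxter equation. Let $g\colon X\to Y$ be a map for some subset $Y\subseteq A$. Assume that there exists a map $X\times Y\to X$, $(x,y)\mapsto x\odot y$, such that $$\lambda_x(y\odot g(z))=\lambda_x(y)\odot g(z)$$ for all $x,y,z\in X$. Let $f\colon X\to X$ be $\mathcal{G}(X,r)$-equivariant and let $k\colon X\to X$ be given by $k(x)=f(x)\odot g(x)$. Then $k$ is a reflection of $(X,r)$ if and only if $$f(x)\odot g(\mu_{k(y)}(x))=f(x)\odot g(\mu_y(x))$$ for all $x,y\in X$.
   Context: A left brace is a triple $(A,+,\circ)$ such that $(A,+)$ is an abelian group, $(A,\circ)$ is a group and $a\circ(b+c)=a\circ b-a+a\circ c$ for all $a,b,c\in A$. Put $\lambda_a(b)=-a+a\circ b$, write $x'$ for the inverse of $x$ in $(A,\circ)$, and put $\mu_b(a)=\lambda_a(b)'\circ a\circ b$. The map $r_A\colon A\times A\to A\times A$, $r_A(a,b)=(\lambda_a(b),\mu_b(a))$, is an involutive non-degenerate solution to the Yang--Baxter equation (YBE). A solution to the YBE is a pair $(X,r)$ with $X$ a set and $r\colon X\times X\to X\times X$ bijective satisfying $(r\times\mathrm{id})(\mathrm{id}\times r)(r\times\mathrm{id})=(\mathrm{id}\times r)(r\times\mathrm{id})(\mathrm{id}\times r)$; writing $r(x,y)=(\sigma_x(y),\tau_y(x))$, it is non-degenerate if all $\sigma_x,\tau_x\colon X\to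 X$ are bijective, and involutive if $r^2=\mathrm{id}$. A map $k\colon X\to X$ is a reflection of a non-degenerate solution $(X,r)$ if $r(\mathrm{id}\times k)r(\mathrm{id}\times k)=(\mathrm{id}\times k)r(\mathrm{id}\times k)r$. For $(X,r)$ involutive and non-degenerate, $\mathcal{G}(X,r)$ is the group of permutations of $X$ generated by $\{\sigma_x:x\in X\}$, and $f\colon X\to X$ is $\mathcal{G}(X,r)$-equivariant if $f\sigma_x=\sigma_xf$ for all $x\in X$. For $r=r_A|_{X\times X}$ one has $\sigma_x=\lambda_x|_X$ and $\tau_x=\mu_x|_X$. *)

theory Defs
  imports "HOL-Algebra.Ring"
begin

text \<open>
  A left brace is carried by the record type of rings: \<open>\<oplus>\<close> is the additive operation \<open>+\<close>, and
  \<open>\<otimes>\<close> is the circle operation of the brace. No ring axioms are assumed; in particular \<open>\<otimes>\<close> is a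
  group operation on the whole carrier, and \<open>\<zero> = \<one>\<close> is a consequence of the axioms.
\<close>

locale left_brace = abelian_group A + group A for A (structure) +
  assumes brace_distrib:
    "\<lbrakk>a \<in> carrier A; b \<in> carrier A; c \<in> carrier A\<rbrakk>
      \<Longrightarrow> a \<otimes> (b \<oplus> c) = ((a \<otimes> b) \<ominus> a) \<oplus> (a \<otimes> c)"

definition brace_lambda :: "('a, 'm) ring_scheme \<Rightarrow> 'a \<Rightarrow> 'a \<Rightarrow> 'a" where
  "brace_lambda A a b = (\<ominus>\<^bsub>A\<^esub> a) \<oplus>\<^bsub>A\<^esub> (a \<otimes>\<^bsub>A\<^esub> b)"

text \<open>The subscript comes first: \<open>brace_mu A b a\<close> is \<open>\<mu>\<^sub>b(a)\<close>.\<close>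

definition brace_mu :: "('a, 'm) ring_scheme \<Rightarrow> 'a \<Rightarrow> 'a \<Rightarrow> 'a" where
  "brace_mu A b a = (inv\<^bsub>A\<^esub> (brace_lambda A a b)) \<otimes>\<^bsub>A\<^esub> a \<otimes>\<^bsub>A\<^esub> b"

definition brace_map :: "('a, 'm) ring_scheme \<Rightarrow> 'a \<times> 'a \<Rightarrow> 'a \<times> 'a" where
  "brace_map A = (\<lambda>(a, b). (brace_lambda A a b, brace_mu A b a))"

text \<open>
  A map \<open>X \<times> X \<rightarrow> X \<times> X\<close> is a total function on pairs of which only the values on \<open>X \<times> X\<close>
  matter. Triples are nested to the right, so \<open>id \<times> r\<close> is a \<open>map_prod\<close> but \<open>r \<times> id\<close> is not.
\<close>

definition left_ext :: "('a \<times> 'a \<Rightarrow> 'a \<times> 'a) \<Rightarrow> 'a \<times> 'a \<times> 'a \<Rightarrow> 'a \<times> 'a \<times> 'a" where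
  "left_ext r = (\<lambda>(x, y, z). (fst (r (x, y)), snd (r (x, y)), z))"

definition right_ext :: "('a \<times> 'a \<Rightarrow> 'a \<times> 'a) \<Rightarrow> 'a \<times> 'a \<times> 'a \<Rightarrow> 'a \<times> 'a \<times> 'a" where
  "right_ext r = map_prod id r"

definition ybe_solution :: "'a set \<Rightarrow> ('a \<times> 'a \<Rightarrow> 'a \<times> 'a) \<Rightarrow> bool" where
  "ybe_solution X r \<longleftrightarrow>
     bij_betw r (X \<times> X) (X \<times> X) \<and>
     (\<forall>t \<in> X \<times> X \<times> X.
        (left_ext r \<circ> right_ext r \<circ> left_ext r) t = (right_ext r \<circ> left_ext r \<circ> right_ext r) t)"

definition sol_sigma :: "('a \<times> 'a \<Rightarrow> 'a \<times> 'a) \<Rightarrow> 'a \<Rightarrow> 'a \<Rightarrow> 'a" where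
  "sol_sigma r x y = fst (r (x, y))"

text \<open>Again the subscript comes first: \<open>r(x, y) = (\<sigma>\<^sub>x(y), \<tau>\<^sub>y(x))\<close>.\<close>

definition sol_tau :: "('a \<times> 'a \<Rightarrow> 'a \<times> 'a) \<Rightarrow> 'a \<Rightarrow> 'a \<Rightarrow> 'a" where
  "sol_tau r y x = snd (r (x, y))"

definition nondegenerate :: "'a set \<Rightarrow> ('a \<times> 'a \<Rightarrow> 'a \<times> 'a) \<Rightarrow> bool" where
  "nondegenerate X r \<longleftrightarrow>
     (\<forall>x \<in> X. bij_betw (sol_sigma r x) X X \<and> bij_betw (sol_tau r x) X X)"

definition reflection :: "'a set \<Rightarrow> ('a \<times> 'a \<Rightarrow> 'a \<times> 'a) \<Rightarrow> ('a \<Rightarrow> 'a) \<Rightarrow> bool" where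
  "reflection X r k \<longleftrightarrow>
     k \<in> X \<rightarrow> X \<and>
     (\<forall>p \<in> X \<times> X.
        (r \<circ> map_prod id k \<circ> r \<circ> map_prod id k) p = (map_prod id k \<circ> r \<circ> map_prod id k \<circ> r) p)"

text \<open>
  Equivariance of a self-map of \<open>X\<close> under the permutation group generated by the \<open>\<sigma>\<^sub>x\<close> is, by
  definition, commutation with these generators.
\<close>

definition equivariant :: "'a set \<Rightarrow> ('a \<times> 'a \<Rightarrow> 'a \<times> 'a) \<Rightarrow> ('a \<Rightarrow> 'a) \<Rightarrow> bool" where
  "equivariant X r f \<longleftrightarrow>
     f \<in> X \<rightarrow> X \<and> (\<forall>x \<in> X. \<forall>y \<in> X. f (sol_sigma r x y) = sol_sigma r x (f y))"

end

theory Submission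
  imports Defs
begin

text \<open>
  For an involutive solution, \<open>\<sigma>\<^bsub>\<sigma>\<^sub>x(y)\<^esub>(\<tau>\<^sub>y(x)) = x\<close>. Together with the equivariance of \<open>f\<close> and
  the compatibility of \<open>\<odot>\<close> with \<open>\<sigma>\<close>, this makes the first components of the two sides of the
  reflection equation at \<open>(x, y)\<close> equal to \<open>f(x) \<odot> g(\<tau>\<^bsub>k(y)\<^esub>(x))\<close> and \<open>f(x) \<odot> g(\<tau>\<^sub>y(x))\<close>. The
  second components are then compared after applying the injective map \<open>\<sigma>\<^sub>t\<close>, where \<open>t\<close> is the common
  first component: their equality is the same condition at \<open>r(x, y)\<close> in place of \<open>(x, y)\<close>.
\<close>

lemma reflection_odot_iff:
  fixes s t :: "'a \<Rightarrow> 'a \<Rightarrow> 'a"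
  assumes r: "\<And>x y. \<lbrakk>x \<in> X; y \<in> X\<rbrakk> \<Longrightarrow> r (x, y) = (s x y, t y x)"
    and s_bij: "\<And>x. x \<in> X \<Longrightarrow> bij_betw (s x) X X"
    and t_closed: "\<And>x y. \<lbrakk>x \<in> X; y \<in> X\<rbrakk> \<Longrightarrow> t y x \<in> X"
    and inv_s: "\<And>x y. \<lbrakk>x \<in> X; y \<in> X\<rbrakk> \<Longrightarrow> s (s x y) (t y x) = x"
    and inv_t: "\<And>x y. \<lbrakk>x \<in> X; y \<in> X\<rbrakk> \<Longrightarrow> t (t y x) (s x y) = y"
    and odot_closed: "\<And>x y. \<lbrakk>x \<in> X; y \<in> X\<rbrakk> \<Longrightarrow> odot x (g y) \<in> X"
    and s_odot: "\<And>x y z. \<lbrakk>x \<in> X; y \<in> X; z \<in> X\<rbrakk> \<Longrightarrow> s x (odot y (g z)) = odot (s x y) (g z)"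
    and f_closed: "\<And>x. x \<in> X \<Longrightarrow> f x \<in> X"
    and f_s: "\<And>x y. \<lbrakk>x \<in> X; y \<in> X\<rbrakk> \<Longrightarrow> f (s x y) = s x (f y)"
    and k: "\<And>x. x \<in> X \<Longrightarrow> k x = odot (f x) (g x)"
  shows "reflection X r k \<longleftrightarrow> (\<forall>x\<in>X. \<forall>y\<in>X. odot (f x) (g (t (k y) x)) = odot (f x) (g (t y x)))"
proof -
  have s_closed: "s x y \<in> X" if "x \<in> X" "y \<in> X" for x y
    using s_bij[OF that(1)] that(2) by (auto simp: bij_betw_def)
  have k_closed: "k x \<in> X" if "x \<in> X" for x
    using that by (simp add: k odot_closed f_closed)
  note closed = s_closed t_closed k_closed f_closed odot_closed
  \<comment> \<open>\<open>s x\<close> passes through \<open>odot\<close> by acting on the first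
    argument alone, so \<open>g\<close> stays at \<open>y\<close>, whereas \<open>k (s x y)\<close>
    has \<open>g\<close> at \<open>s x y\<close>.\<close>
  have s_k: "s x (k y) = odot (f (s x y)) (g y)" if "x \<in> X" "y \<in> X" for x y
    using that by (simp add: k s_odot f_s closed)
  \<comment> \<open>This is \<open>s_k\<close> at the pair \<open>(s x y, t y x)\<close>: by
    \<open>inv_s\<close>, the argument of \<open>f\<close> collapses to \<open>x\<close>.\<close>
  have first: "s (s x y) (k (t y x)) = odot (f x) (g (t y x))" if "x \<in> X" "y \<in> X" for x y
    using that by (simp add: s_k inv_s closed)
  have left: "(r \<circ> map_prod id k \<circ> r \<circ> map_prod id k) (x, y) =
      (odot (f x) (g (t (k y) x)), t (k (t (k y) x)) (s x (k y)))" if "x \<in> X" "y \<in> X" for x y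
    using that by (simp add: r closed first)
  have right: "(map_prod id k \<circ> r \<circ> map_prod id k \<circ> r) (x, y) =
      (odot (f x) (g (t y x)), k (t (k (t y x)) (s x y)))" if "x \<in> X" "y \<in> X" for x y
    using that by (simp add: r closed first)
  have second: "t (k (t (k y) x)) (s x (k y)) = k (t (k (t y x)) (s x y))"
    if x: "x \<in> X" and y: "y \<in> X"
      and C: "\<And>x y. \<lbrakk>x \<in> X; y \<in> X\<rbrakk> \<Longrightarrow> odot (f x) (g (t (k y) x)) = odot (f x) (g (t y x))"
    for x y
  proof -
    define p where "p = odot (f x) (g (t y x))"
    define v where "v = t (k (t (k y) x)) (s x (k y))"
    define u where "u = t (k (t y x)) (s x y)"
    have X: "p \<in> X" "u \<in> X" "v \<in> X"
      using x y by (simp_all add: p_def u_def v_def closed)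
    \<comment> \<open>The condition \<open>C\<close> trades \<open>y\<close> for \<open>k y\<close>
      under \<open>t\<close>; then \<open>first\<close> at \<open>(x, k y)\<close> applies.\<close>
    have p_left: "p = s (s x (k y)) (k (t (k y) x))"
      using x y by (simp add: p_def first closed C)
    have p_right: "p = s (s x y) (k (t y x))"
      using x y by (simp add: p_def first)
    \<comment> \<open>\<open>inv_s\<close> at the pair \<open>(s x (k y), k (t (k y) x))\<close>,
      whose image under \<open>r\<close> is \<open>(p, v)\<close>.\<close>
    have "s p v = s x (k y)"
      using x y by (simp only: p_left v_def inv_s closed)
    also have "\<dots> = odot (f (s x y)) (g y)"
      using x y by (rule s_k)
    \<comment> \<open>At the pair \<open>(s x y, t y x)\<close>, one side of \<open>C\<close> has
      \<open>g u\<close>; the other has \<open>g y\<close>, since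
      \<open>t (t y x) (s x y) = y\<close>.\<close>
    also have "\<dots> = odot (f (s x y)) (g u)"
      using C[of "s x y" "t y x"] x y by (simp add: u_def inv_t closed)
    also have "s x y = s p u"
      using x y by (simp only: p_right u_def inv_s closed)
    \<comment> \<open>\<open>s_k\<close> read backwards reassembles \<open>k u\<close>.\<close>
    also have "odot (f (s p u)) (g u) = s p (k u)"
      using X by (simp add: s_k)
    finally have "s p v = s p (k u)" .
    then have "v = k u"
      using s_bij[OF X(1)] X k_closed by (auto simp: bij_betw_def dest: inj_onD)
    then show ?thesis by (simp add: u_def v_def)
  qed
  show ?thesis
  proof
    assume "reflection X r k"
    then have "(r \<circ> map_prod id k \<circ> r \<circ> map_prod id k) (x, y) =
        (map_prod id k \<circ> r \<circ> map_prod id k \<circ> r) (x, y)" if "x \<in> X" "y \<in> X" for x y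
      using that unfolding reflection_def by blast
    \<comment> \<open>The condition is read off from the first components.\<close>
    then show "\<forall>x\<in>X. \<forall>y\<in>X. odot (f x) (g (t (k y) x)) = odot (f x) (g (t y x))"
      by (metis left right Pair_inject)
  next
    assume C: "\<forall>x\<in>X. \<forall>y\<in>X. odot (f x) (g (t (k y) x)) = odot (f x) (g (t y x))"
    have "(r \<circ> map_prod id k \<circ> r \<circ> map_prod id k) (x, y) =
        (map_prod id k \<circ> r \<circ> map_prod id k \<circ> r) (x, y)" if "x \<in> X" "y \<in> X" for x y
      unfolding left[OF that] right[OF that] using that C second[of x y] by simp
    then show "reflection X r k"
      unfolding reflection_def using k_closed by blast
  qed
qed

context left_brace
begin

lemma brace_lambda_closed:
  "\<lbrakk>a \<in> carrier A; b \<in> carrier A\<rbrakk> \<Longrightarrow> brace_lambda A a b \<in> carrier A"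
  by (simp add: brace_lambda_def)

text \<open>The leading inverse in the definition of \<open>brace_mu\<close> cancels:
  \<open>brace_map A\<close> preserves circle products.\<close>

lemma lambda_mult_mu:
  assumes "a \<in> carrier A" "b \<in> carrier A"
  shows "brace_lambda A a b \<otimes> brace_mu A b a = a \<otimes> b"
  using assms brace_lambda_closed[OF assms] by (simp add: brace_mu_def m_assoc[symmetric])

text \<open>With \<open>l = brace_lambda A a b\<close>, the left side is
  \<open>-l + a \<otimes> b\<close> by \<open>lambda_mult_mu\<close>, and
  \<open>l = -a + a \<otimes> b\<close>.\<close>

lemma lambda_lambda_mu:
  assumes "a \<in> carrier A" "b \<in> carrier A"
  shows "brace_lambda A (brace_lambda A a b) (brace_mu A b a) = a"
proof -
  have "\<ominus> (brace_lambda A a b) = \<ominus> (a \<otimes> b) \<oplus> a"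
    using assms by (simp add: brace_lambda_def minus_add a_comm)
  then show ?thesis
    using assms
    by (simp add: brace_lambda_def[of A "brace_lambda A a b"] lambda_mult_mu a_ac brace_lambda_closed r_neg)
qed

text \<open>The second half of involutivity: applied to the image pair, \<open>brace_mu\<close> is
  the inverse of \<open>a\<close>, by \<open>lambda_lambda_mu\<close>, times the preserved product
  \<open>a \<otimes> b\<close>.\<close>

lemma mu_mu_lambda:
  assumes "a \<in> carrier A" "b \<in> carrier A"
  shows "brace_mu A (brace_mu A b a) (brace_lambda A a b) = b"
proof -
  have "brace_mu A b a \<in> carrier A"
    using assms brace_lambda_closed by (simp add: brace_mu_def)
  then have "brace_mu A (brace_mu A b a) (brace_lambda A a b)
      = inv a \<otimes> (brace_lambda A a b \<otimes> brace_mu A b a)"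
    \<comment> \<open>Only the outer \<open>brace_mu\<close> is unfolded, so that the inner one
      still matches \<open>lambda_lambda_mu\<close>.\<close>
    using assms brace_lambda_closed
    by (subst brace_mu_def) (simp add: lambda_lambda_mu m_assoc)
  also have "\<dots> = b"
    using assms by (simp add: lambda_mult_mu m_assoc[symmetric])
  finally show ?thesis .
qed

end

theorem theorem2p1:
  fixes A :: "('a, 'm) ring_scheme"
    and X Y :: "'a set"
    and r :: "'a \<times> 'a \<Rightarrow> 'a \<times> 'a"
    and f g k :: "'a \<Rightarrow> 'a"
    and odot :: "'a \<Rightarrow> 'a \<Rightarrow> 'a"
  assumes "left_brace A"
    and "X \<subseteq> carrier A"
    and "r = restrict (brace_map A) (X \<times> X)"
    and "ybe_solution X r"
    and "nondegenerate X r"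
    and "Y \<subseteq> carrier A"
    and "g \<in> X \<rightarrow> Y"
    and "\<And>x y. \<lbrakk>x \<in> X; y \<in> Y\<rbrakk> \<Longrightarrow> odot x y \<in> X"
    and "\<And>x y z. \<lbrakk>x \<in> X; y \<in> X; z \<in> X\<rbrakk>
           \<Longrightarrow> brace_lambda A x (odot y (g z)) = odot (brace_lambda A x y) (g z)"
    and "equivariant X r f"
    and "\<And>x. x \<in> X \<Longrightarrow> k x = odot (f x) (g x)"
  shows "reflection X r k \<longleftrightarrow>
    (\<forall>x \<in> X. \<forall>y \<in> X.
       odot (f x) (g (brace_mu A (k y) x)) = odot (f x) (g (brace_mu A y x)))"
proof (rule reflection_odot_iff[where s = "brace_lambda A" and t = "brace_mu A"])
  interpret left_brace A by fact
  have r: "r (x, y) = (brace_lambda A x y, brace_mu A y x)" if "x \<in> X" "y \<in> X" for x y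
    using that by (simp add: assms(3) brace_map_def)
  have sub: "x \<in> carrier A" if "x \<in> X" for x
    using that assms(2) by blast
  have sigma: "bij_betw (brace_lambda A x) X X" and tau: "bij_betw (brace_mu A x) X X"
    if "x \<in> X" for x
  proof -
    have "bij_betw (sol_sigma r x) X X" "bij_betw (sol_tau r x) X X"
      using assms(5) that by (auto simp: nondegenerate_def)
    \<comment> \<open>As \<open>r\<close> is a restriction, its component maps agree with those of
      the brace only on \<open>X\<close>; hence the congruence rule.\<close>
    then show "bij_betw (brace_lambda A x) X X" "bij_betw (brace_mu A x) X X"
      using that by (simp_all add: sol_sigma_def sol_tau_def r cong: bij_betw_cong)
  qed
  have f: "f x \<in> X" if "x \<in> X" for x
    using assms(10) that by (auto simp: equivariant_def)
  fix x y z
  assume x: "x \<in> X"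
  show "bij_betw (brace_lambda A x) X X" using x by (rule sigma)
  show "f x \<in> X" using x by (rule f)
  show "k x = odot (f x) (g x)" using x by (rule assms(11))
  assume y: "y \<in> X"
  show "r (x, y) = (brace_lambda A x y, brace_mu A y x)" using x y by (rule r)
  show "brace_mu A y x \<in> X" using tau[OF y] x by (auto simp: bij_betw_def)
  show "brace_lambda A (brace_lambda A x y) (brace_mu A y x) = x"
    using x y by (simp add: lambda_lambda_mu sub)
  show "brace_mu A (brace_mu A y x) (brace_lambda A x y) = y"
    using x y by (simp add: mu_mu_lambda sub)
  show "odot x (g y) \<in> X" using x y assms(7,8) by blast
  show "f (brace_lambda A x y) = brace_lambda A x (f y)"
    using assms(10) x y by (simp add: equivariant_def sol_sigma_def r f)
  assume z: "z \<in> X"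
  show "brace_lambda A x (odot y (g z)) = odot (brace_lambda A x y) (g z)"
    using x y z by (rule assms(9))
qed

end
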